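(* Let $n_1,n_2$ be positive integers, and let $x^1\in\mathbb{R}^{n_1}$ and $x^2\in\mathbb{R}^{n_2}$ be vectors of variables with no components in common. Let $P_1=\{x^1\in\mathbb{R}^{n_1}: A_1x^1\le a_1\}$ and $P_2=\{x^2\in\mathbb{R}^{n_2}: A_2x^2\le a_2\}$ be any non-empty polytopes, where $A_1\in\mathbb{R}^{p_1\times n_1}$, $a_1\in\mathbb{R}^{p_1}$, $A_2\in\mathbb{R}^{p_2\times n_2}$, $a_2\in\mathbb{R}^{p_2}$. Then the inequality description of $P_1$ can be augmented, by adding redundant variables and constraints, into an extended formulation of $P_2$; and, vice versa, the inequality description of $P_2$ can be augmented, by adding redundant variables and constraints, into an extended formulation of $P_1$. Here "extended formulation" may be taken in the sense of any of the definitions (D1), (D2), (D3).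
   Context: A polytope is a bounded set of the form $\{x: Ax\le a\}$ with finitely many inequalities. Extended formulations. Let $X\subseteq\mathbb{R}^p$ be a polytope and let $U=\{(x,w)\in\mathbb{R}^{p+q}: Gx+Hw\le g\}$ be a polyhedron, with $G\in\mathbb{R}^{m\times p}$, $H\in\mathbb{R}^{m\times q}$, $g\in\mathbb{R}^m$. (Equality constraints are allowed, since each can be written as a pair of inequalities.) (D1) $U$ is an extended formulation of $X$ if $\varphi_x(U)=X$, where $\varphi_x(U):=\{x\in\mathbb{R}^p: \exists w\in\mathbb{R}^q,\ (x,w)\in U\}$ is the projection of $U$ onto $x$-space. (D2) $U$ is an extended formulation of $X$ if there exists a linear map $\pi:\mathbb{R}^{p+q}\to\mathbb{R}^p$ such that $X=\pi(U)$. (D3) $U$ is an extended formulation of $X$ if for every $x\in\mathbb{R}^p$: $x\in X$ if and only if there exists $w\in\mathbb{R}^q$ with $(x,w)\in U$. When $U$ is described in several groups of variables, one of which is $x$, the remaining variables together play the role of $w$. Augmentation. Let $P=\{y\in\mathbb{R}^n: Ay\le a\}$. To augment the inequality description of $P$ by redundant variables and constraints means to pass to a system of finitely many linear inequalities in variables $(y,v)\in\mathbb{R}^n\times\mathbb{R}^k$, for some integer $k\ge 0$, such that the system contains the constraints $Ay\le a$ (possibly with each inequality multiplied by a positive scalar), and the added variables $v$ and the added constraints are redundant for $P$: for every $y\in P$ there exists $v\in\mathbb{R}^k$ such that $(y,v)$ satisfies all the constraints of the system (so the projection of the augmented system onto $y$-space is exactly $P$). *)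

theory Defs
  imports "Jordan_Normal_Form.VS_Connect"
begin

definition polyhedron :: "nat \<Rightarrow> real mat \<Rightarrow> real vec \<Rightarrow> real vec set" where
  "polyhedron n A a = {x \<in> carrier_vec n. A *\<^sub>v x \<le> a}"

definition bounded_vecs :: "real vec set \<Rightarrow> bool" where
  "bounded_vecs X \<longleftrightarrow> (\<exists>M. \<forall>x\<in>X. \<forall>i<dim_vec x. \<bar>x $ i\<bar> \<le> M)"

definition polytope :: "nat \<Rightarrow> real vec set \<Rightarrow> bool" where
  "polytope n X \<longleftrightarrow> bounded_vecs X \<and>
     (\<exists>p A a. A \<in> carrier_mat p n \<and> a \<in> carrier_vec p \<and> X = polyhedron n A a)"

text \<open>The polyhedron of all \<open>(x, w)\<close> in \<open>\<real>\<^sup>p \<times> \<real>\<^sup>q\<close> with \<open>G x + H w \<le> g\<close>; pairs are concatenated vectors.\<close>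

definition polyhedron2 ::
  "nat \<Rightarrow> nat \<Rightarrow> real mat \<Rightarrow> real mat \<Rightarrow> real vec \<Rightarrow> real vec set" where
  "polyhedron2 p q G H g =
     {x @\<^sub>v w | x w. x \<in> carrier_vec p \<and> w \<in> carrier_vec q \<and> G *\<^sub>v x + H *\<^sub>v w \<le> g}"

text \<open>The three definitions of ``\<open>U \<subseteq> \<real>\<^sup>p\<^sup>+\<^sup>q\<close> is an extended formulation of \<open>X \<subseteq> \<real>\<^sup>p\<close>''; the
  first \<open>p\<close> coordinates of \<open>U\<close> are those of \<open>x\<close>.\<close>

definition proj_x :: "nat \<Rightarrow> nat \<Rightarrow> real vec set \<Rightarrow> real vec set" where
  "proj_x p q U = {x \<in> carrier_vec p. \<exists>w \<in> carrier_vec q. x @\<^sub>v w \<in> U}"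

definition ext_formulation_D1 :: "nat \<Rightarrow> nat \<Rightarrow> real vec set \<Rightarrow> real vec set \<Rightarrow> bool" where
  "ext_formulation_D1 p q U X \<longleftrightarrow> proj_x p q U = X"

definition ext_formulation_D2 :: "nat \<Rightarrow> nat \<Rightarrow> real vec set \<Rightarrow> real vec set \<Rightarrow> bool" where
  "ext_formulation_D2 p q U X \<longleftrightarrow>
     (\<exists>\<pi>. linear_map class_ring (module_vec TYPE(real) (p + q)) (module_vec TYPE(real) p) \<pi> \<and>
        X = \<pi> ` U)"

definition ext_formulation_D3 :: "nat \<Rightarrow> nat \<Rightarrow> real vec set \<Rightarrow> real vec set \<Rightarrow> bool" where
  "ext_formulation_D3 p q U X \<longleftrightarrow>
     (\<forall>x \<in> carrier_vec p. x \<in> X \<longleftrightarrow> (\<exists>w \<in> carrier_vec q. x @\<^sub>v w \<in> U))"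

text \<open>The system \<open>B y + C v \<le> b\<close> in \<open>(y, v) \<in> \<real>\<^sup>n \<times> \<real>\<^sup>k\<close> augments \<open>A y \<le> a\<close>: each inequality of
  \<open>A y \<le> a\<close> occurs in it up to a positive factor, with zero coefficients on \<open>v\<close>, and every solution
  \<open>y\<close> of \<open>A y \<le> a\<close> extends to a solution of the system.\<close>

definition augmentation ::
  "nat \<Rightarrow> nat \<Rightarrow> real mat \<Rightarrow> real vec \<Rightarrow> real mat \<Rightarrow> real mat \<Rightarrow> real vec \<Rightarrow> bool" where
  "augmentation n k A a B C b \<longleftrightarrow>
     (\<forall>i < dim_row A. \<exists>j < dim_row B. \<exists>c > 0.
        row B j = c \<cdot>\<^sub>v row A i \<and> row C j = 0\<^sub>v k \<and> b $ j = c * a $ i) \<and>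
     (\<forall>y \<in> polyhedron n A a. \<exists>v \<in> carrier_vec k. y @\<^sub>v v \<in> polyhedron2 n k B C b)"

definition append_cols :: "real mat \<Rightarrow> real mat \<Rightarrow> real mat" (infixr \<open>@\<^sub>c\<close> 65) where
  "A @\<^sub>c B = four_block_mat A B (0\<^sub>m 0 (dim_col A)) (0\<^sub>m 0 (dim_col B))"

text \<open>The description \<open>A y \<le> a\<close> in \<open>y \<in> \<real>\<^sup>n\<close> can be augmented into an extended formulation of
  \<open>X \<subseteq> \<real>\<^sup>p\<close>, in the sense \<open>EF\<close>. The coordinates of \<open>x \<in> \<real>\<^sup>p\<close> are disjoint from those of \<open>y\<close>, so
  the augmented system is \<open>B y + G x + H u \<le> b\<close>, where \<open>u\<close> are further variables. The added
  variables are \<open>v = (x, u)\<close>; as an extended formulation of \<open>X\<close>, the same system is read in the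
  variables \<open>(x, w)\<close> with \<open>w = (y, u)\<close>.\<close>

definition augmentable_into ::
  "(nat \<Rightarrow> nat \<Rightarrow> real vec set \<Rightarrow> real vec set \<Rightarrow> bool) \<Rightarrow>
   nat \<Rightarrow> real mat \<Rightarrow> real vec \<Rightarrow> nat \<Rightarrow> real vec set \<Rightarrow> bool" where
  "augmentable_into EF n A a p X \<longleftrightarrow>
     (\<exists>m r B G H b.
        B \<in> carrier_mat m n \<and> G \<in> carrier_mat m p \<and> H \<in> carrier_mat m r \<and> b \<in> carrier_vec m \<and>
        augmentation n (p + r) A a B (G @\<^sub>c H) b \<and>
        EF p (n + r) (polyhedron2 p (n + r) G (B @\<^sub>c H) b) X)"

end

theory Submission
  imports Defs
begin

text \<open>The product \<open>P\<^sub>1 \<times> P\<^sub>2\<close>, described by the two systems side by side, projects onto each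
  factor since the other one is non-empty. It is therefore an augmentation of either description and
  an extended formulation of either polytope, with no further variables.\<close>

text \<open>A concatenation splits in only one way once the dimension of its first part is fixed, so
  the existential in \<open>polyhedron2\<close> can be eliminated.\<close>

lemma append_in_polyhedron2_iff:
  assumes "x \<in> carrier_vec p" "w \<in> carrier_vec q"
  shows "x @\<^sub>v w \<in> polyhedron2 p q G H g \<longleftrightarrow> G *\<^sub>v x + H *\<^sub>v w \<le> g"
  using assms unfolding polyhedron2_def by (auto simp: append_vec_eq[of _ p])

text \<open>Serves the case of no further variables \<open>u\<close>, whose coefficient matrix has
  no columns.\<close>

lemma append_cols_empty:
  assumes "H \<in> carrier_mat m 0"
    and "G \<in> carrier_mat m p"
  shows "G @\<^sub>c H = G"
  using assms unfolding append_cols_def by (intro eq_matI) auto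

lemma zero_mult_mat_vec:
  fixes x :: "'a :: semiring_0 vec"
  assumes "x \<in> carrier_vec n"
  shows "0\<^sub>m m n *\<^sub>v x = 0\<^sub>v m"
  using assms by (intro eq_vecI) auto

text \<open>The stacked matrices are the two block columns of a block-diagonal system: each zero
  block keeps one group of variables out of the other group's inequalities, so the system
  decouples.\<close>

lemma append_rows_product_le:
  fixes A C :: "'a :: {comm_semiring_0,ord} mat"
  assumes A: "A \<in> carrier_mat p n" and a: "a \<in> carrier_vec p" and y: "y \<in> carrier_vec n"
    and C: "C \<in> carrier_mat q l" and x: "x \<in> carrier_vec l"
  shows "(A @\<^sub>r 0\<^sub>m q n) *\<^sub>v y + (0\<^sub>m p l @\<^sub>r C) *\<^sub>v x \<le> a @\<^sub>v c \<longleftrightarrow> A *\<^sub>v y \<le> a \<and> C *\<^sub>v x \<le> c"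
proof -
  have "(A @\<^sub>r 0\<^sub>m q n) *\<^sub>v y + (0\<^sub>m p l @\<^sub>r C) *\<^sub>v x = (A *\<^sub>v y @\<^sub>v 0\<^sub>v q) + (0\<^sub>v p @\<^sub>v C *\<^sub>v x)"
    using mat_mult_append[OF A zero_carrier_mat y] mat_mult_append[OF zero_carrier_mat C x]
      zero_mult_mat_vec[OF x] zero_mult_mat_vec[OF y] by simp
  also have "\<dots> = A *\<^sub>v y @\<^sub>v C *\<^sub>v x"
    using assms by (subst append_vec_add[of _ p _ _ q]) auto
  finally show ?thesis
    using append_vec_le[OF mult_mat_vec_carrier[OF A y] a] by simp
qed

lemma linear_map_vec_first:
  "linear_map class_ring (module_vec TYPE('a :: field) (p + q)) (module_vec TYPE('a) p)
     (\<lambda>v. vec_first v p)"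
proof -
  let ?first = "\<lambda>v :: 'a vec. vec_first v p"
  have "?first (u + v) = ?first u + ?first v"
    if "u \<in> carrier_vec (p + q)" "v \<in> carrier_vec (p + q)" for u v
    using that unfolding vec_first_def by (intro eq_vecI) auto
  moreover have "?first (c \<cdot>\<^sub>v v) = c \<cdot>\<^sub>v ?first v" if "v \<in> carrier_vec (p + q)" for c v
    using that unfolding vec_first_def by (intro eq_vecI) auto
  ultimately have "?first \<in> LinearCombinations.module_hom class_ring
      (module_vec TYPE('a) (p + q)) (module_vec TYPE('a) p)"
    unfolding LinearCombinations.module_hom_def module_vec_simps by simp
  then show ?thesis
    by (intro linear_map.intro mod_hom.intro mod_hom_axioms.intro vec_vs vec_module)
qed

text \<open>Restriction to the first \<open>p\<close> coordinates is linear and serves as the map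
  \<open>\<pi>\<close>.\<close>

lemma ext_formulation_D1_imp_D2:
  assumes "ext_formulation_D1 p q (polyhedron2 p q G H g) X"
  shows "ext_formulation_D2 p q (polyhedron2 p q G H g) X"
proof -
  have first: "vec_first (x @\<^sub>v w) p = x" if "x \<in> carrier_vec p" for x w :: "real vec"
    using that unfolding vec_first_def by (intro eq_vecI) auto
  have "proj_x p q (polyhedron2 p q G H g) = (\<lambda>v. vec_first v p) ` polyhedron2 p q G H g" (is "?L = ?R")
  proof
    show "?L \<subseteq> ?R" unfolding proj_x_def by (auto intro!: image_eqI simp: first)
    \<comment> \<open>Every element of \<open>polyhedron2\<close> is a concatenation
      \<open>x @\<^sub>v w\<close> with both parts of the right dimension, so \<open>w\<close>
      itself witnesses membership in the projection.\<close>
    show "?R \<subseteq> ?L" unfolding proj_x_def polyhedron2_def by (fastforce simp: first)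
  qed
  then show ?thesis
    using assms linear_map_vec_first unfolding ext_formulation_D1_def ext_formulation_D2_def by blast
qed

lemma ext_formulation_D1_imp_D3:
  assumes "ext_formulation_D1 p q U X"
  shows "ext_formulation_D3 p q U X"
  using assms unfolding ext_formulation_D1_def ext_formulation_D3_def proj_x_def by auto

text \<open>One direction of the theorem, with \<open>x\<close> as the only added variables. It
  suffices to verify (D1), from which (D2) and (D3) follow.\<close>

lemma augmentable_into_nonempty_polyhedron:
  assumes A: "A \<in> carrier_mat p n" and a: "a \<in> carrier_vec p"
    and C: "C \<in> carrier_mat q l" and c: "c \<in> carrier_vec q"
    and P: "polyhedron n A a \<noteq> {}" and Q: "polyhedron l C c \<noteq> {}"
    and EF: "EF \<in> {ext_formulation_D1, ext_formulation_D2, ext_formulation_D3}"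
  shows "augmentable_into EF n A a l (polyhedron l C c)"
proof -
  define B where "B = A @\<^sub>r 0\<^sub>m q n"
  define G where "G = 0\<^sub>m p l @\<^sub>r C"
  define H :: "real mat" where "H = 0\<^sub>m (p + q) 0"
  define b where "b = a @\<^sub>v c"
  have B: "B \<in> carrier_mat (p + q) n" and G: "G \<in> carrier_mat (p + q) l"
    and H: "H \<in> carrier_mat (p + q) 0" and b: "b \<in> carrier_vec (p + q)"
    unfolding B_def G_def H_def b_def using A a C c by auto
  have GH: "G @\<^sub>c H = G" and BH: "B @\<^sub>c H = B"
    using append_cols_empty H G B by blast+
  have le: "B *\<^sub>v y + G *\<^sub>v x \<le> b \<longleftrightarrow> y \<in> polyhedron n A a \<and> x \<in> polyhedron l C c"
    if "y \<in> carrier_vec n" "x \<in> carrier_vec l" for x y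
    using that append_rows_product_le[OF A a _ C]
    unfolding B_def G_def b_def polyhedron_def by simp
  \<comment> \<open>The same system with the summands swapped, because the extended formulation
    lists \<open>x\<close> before \<open>y\<close>.\<close>
  have le': "G *\<^sub>v x + B *\<^sub>v y \<le> b \<longleftrightarrow> y \<in> polyhedron n A a \<and> x \<in> polyhedron l C c"
    if "y \<in> carrier_vec n" "x \<in> carrier_vec l" for x y
    using le[OF that] comm_add_vec[of "G *\<^sub>v x" "p + q" "B *\<^sub>v y"] B G that by simp
  have rows: "row B i = row A i \<and> row G i = 0\<^sub>v l \<and> b $ i = a $ i" if "i < p" for i
    using that A C a c unfolding B_def G_def b_def append_rows_def
    by auto
  have "augmentation n l A a B G b"
    unfolding augmentation_def
  proof (intro conjI allI impI ballI)
    fix i assume "i < dim_row A"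
    then have "i < p" using A by simp
    then show "\<exists>j<dim_row B. \<exists>d>0. row B j = d \<cdot>\<^sub>v row A i \<and> row G j = 0\<^sub>v l \<and> b $ j = d * a $ i"
      \<comment> \<open>The rows of \<open>A\<close> sit on top of \<open>B\<close> at their old
        indices and unscaled, hence the witnesses \<open>i\<close> and \<open>1\<close>.\<close>
      using rows[of i] B by (intro exI[of _ i] conjI exI[of _ 1]) auto
  next
    fix y assume y: "y \<in> polyhedron n A a"
    \<comment> \<open>One fixed point of the other polyhedron extends every \<open>y\<close>, since
      the two groups of constraints are independent.\<close>
    obtain x where x: "x \<in> polyhedron l C c" using Q by blast
    have "y \<in> carrier_vec n" "x \<in> carrier_vec l" using x y unfolding polyhedron_def by auto
    then show "\<exists>v\<in>carrier_vec l. y @\<^sub>v v \<in> polyhedron2 n l B G b"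
      using x y by (intro bexI[of _ x]) (simp_all add: append_in_polyhedron2_iff le)
  qed
  moreover have D1: "ext_formulation_D1 l n (polyhedron2 l n G B b) (polyhedron l C c)"
  proof -
    \<comment> \<open>Symmetrically, one fixed \<open>y\<close> lifts every
      \<open>x\<close>.\<close>
    obtain y where "y \<in> polyhedron n A a" using P by blast
    then have "y \<in> carrier_vec n" "y \<in> polyhedron n A a" unfolding polyhedron_def by auto
    moreover have "polyhedron l C c \<subseteq> carrier_vec l" unfolding polyhedron_def by auto
    ultimately show ?thesis
      unfolding ext_formulation_D1_def proj_x_def by (fastforce simp: append_in_polyhedron2_iff le')
  qed
  then have "EF l n (polyhedron2 l n G B b) (polyhedron l C c)"
    using EF ext_formulation_D1_imp_D2 ext_formulation_D1_imp_D3 by blast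
  ultimately show ?thesis
    unfolding augmentable_into_def using B G H b GH BH
    \<comment> \<open>With \<open>r = 0\<close> the dimensions \<open>l + r\<close> and
      \<open>n + r\<close> collapse to \<open>l\<close> and \<open>n\<close>.\<close>
    by (intro exI[of _ "p + q"] exI[of _ 0] exI[of _ B] exI[of _ G] exI[of _ H] exI[of _ b]) simp
qed

theorem theorem7:
  fixes n1 n2 p1 p2 :: nat
    and A1 A2 :: "real mat" and a1 a2 :: "real vec"
  assumes "n1 > 0" and "n2 > 0"
    and "A1 \<in> carrier_mat p1 n1" and "a1 \<in> carrier_vec p1"
    and "A2 \<in> carrier_mat p2 n2" and "a2 \<in> carrier_vec p2"
    and "polytope n1 (polyhedron n1 A1 a1)" and "polyhedron n1 A1 a1 \<noteq> {}"
    and "polytope n2 (polyhedron n2 A2 a2)" and "polyhedron n2 A2 a2 \<noteq> {}"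
  shows "\<forall>EF \<in> {ext_formulation_D1, ext_formulation_D2, ext_formulation_D3}.
           augmentable_into EF n1 A1 a1 n2 (polyhedron n2 A2 a2) \<and>
           augmentable_into EF n2 A2 a2 n1 (polyhedron n1 A1 a1)"
  \<comment> \<open>The two conjuncts are instances of the same lemma with the polytopes
    exchanged.\<close>
  using assms by (intro ballI conjI augmentable_into_nonempty_polyhedron)

end
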